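(* Assume the Singular Cardinal Hypothesis. Let $\kappa$ be a cardinal, $D$ an ultrafilter on $\kappa$, and $(A_i)_{i\in\kappa}$ infinite Boolean algebras with $2^\kappa<\lambda_i=\pi A_i$ for all $i\in\kappa$. Let $A=\prod_{i\in\kappa}A_i/D$. Then $\pi A=\big|\prod_{i\in\kappa}\lambda_i/D\big|$.
   Context: The Singular Cardinal Hypothesis (SCH): for every cardinal $\lambda$, if $2^{\operatorname{cf}\lambda}<\lambda$ then $\lambda^{\operatorname{cf}\lambda}=\lambda^+$. For a Boolean algebra $A$, $\pi A$ is the least cardinality of a set $X\subseteq A\setminus\{0\}$ such that every nonzero element of $A$ is above some element of $X$. $\prod_{i\in\kappa}\lambda_i/D$ is the ultraproduct of the cardinals $\lambda_i$ (the set of $D$-classes of functions $f$ on $\kappa$ with $f(i)<\lambda_i$). *)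

theory Defs
  imports Main "HOL-Library.FuncSet"
begin

text \<open>Cardinals are represented by sets; the cardinal of L is the canonical cardinal
  well-order card_of L on L (an initial ordinal). A subset C of L is cofinal if it is
  unbounded in that well-order; the cofinality cf(|L|) is the least cardinality of a
  cofinal subset.\<close>

definition cofinal_in :: "'a rel \<Rightarrow> 'a set \<Rightarrow> bool" where
  "cofinal_in r C \<longleftrightarrow> C \<subseteq> Field r \<and> (\<forall>a\<in>Field r. \<exists>b\<in>C. (a, b) \<in> r)"

definition min_cofinal :: "'a set \<Rightarrow> 'a set \<Rightarrow> bool" where
  "min_cofinal L C \<longleftrightarrow> cofinal_in (card_of L) C \<and>
     (\<forall>C'. cofinal_in (card_of L) C' \<longrightarrow> ordLeq2 (card_of C) (card_of C'))"

definition SCH :: "'u itself \<Rightarrow> bool" where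
  "SCH _ \<longleftrightarrow> (\<forall>(L::'u set) C. infinite L \<longrightarrow> min_cofinal L C \<longrightarrow>
      ordLess2 (card_of (Pow C)) (card_of L) \<longrightarrow>
      ordIso2 (card_of (Func C L)) (cardSuc (card_of L)))"

record 'a balg =
  bcarrier :: "'a set"
  bjoin :: "'a \<Rightarrow> 'a \<Rightarrow> 'a"
  bmeet :: "'a \<Rightarrow> 'a \<Rightarrow> 'a"
  bcompl :: "'a \<Rightarrow> 'a"
  bzero :: "'a"
  bone :: "'a"

definition boolean_algebra :: "('a, 'b) balg_scheme \<Rightarrow> bool" where
  "boolean_algebra B \<longleftrightarrow>
    bzero B \<in> bcarrier B \<and> bone B \<in> bcarrier B \<and>
    (\<forall>x\<in>bcarrier B. \<forall>y\<in>bcarrier B.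
        bjoin B x y \<in> bcarrier B \<and> bmeet B x y \<in> bcarrier B) \<and>
    (\<forall>x\<in>bcarrier B. bcompl B x \<in> bcarrier B) \<and>
    (\<forall>x\<in>bcarrier B. \<forall>y\<in>bcarrier B.
        bjoin B x y = bjoin B y x \<and> bmeet B x y = bmeet B y x \<and>
        bjoin B x (bmeet B x y) = x \<and> bmeet B x (bjoin B x y) = x) \<and>
    (\<forall>x\<in>bcarrier B. \<forall>y\<in>bcarrier B. \<forall>z\<in>bcarrier B.
        bjoin B x (bjoin B y z) = bjoin B (bjoin B x y) z \<and>
        bmeet B x (bmeet B y z) = bmeet B (bmeet B x y) z \<and>
        bmeet B x (bjoin B y z) = bjoin B (bmeet B x y) (bmeet B x z)) \<and>
    (\<forall>x\<in>bcarrier B. bjoin B x (bcompl B x) = bone B \<and> bmeet B x (bcompl B x) = bzero B \<and>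
        bjoin B x (bzero B) = x \<and> bmeet B x (bone B) = x)"

definition ble :: "('a, 'b) balg_scheme \<Rightarrow> 'a \<Rightarrow> 'a \<Rightarrow> bool" where
  "ble B x y \<longleftrightarrow> bmeet B x y = x"

text \<open>X is a dense set (pi-base): nonzero elements such that every nonzero element is
  above one of them. The pi-weight pi B is the least cardinality of such a set; we say
  that X is a pi-base of least size.\<close>

definition dense_set :: "('a, 'b) balg_scheme \<Rightarrow> 'a set \<Rightarrow> bool" where
  "dense_set B X \<longleftrightarrow> X \<subseteq> bcarrier B - {bzero B} \<and>
     (\<forall>a\<in>bcarrier B - {bzero B}. \<exists>x\<in>X. ble B x a)"

definition min_dense_set :: "('a, 'b) balg_scheme \<Rightarrow> 'a set \<Rightarrow> bool" where
  "min_dense_set B X \<longleftrightarrow> dense_set B X \<and>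
     (\<forall>Y. dense_set B Y \<longrightarrow> ordLeq2 (card_of X) (card_of Y))"

definition ultrafilter_on :: "'k set \<Rightarrow> 'k set set \<Rightarrow> bool" where
  "ultrafilter_on K D \<longleftrightarrow> D \<subseteq> Pow K \<and> K \<in> D \<and> {} \<notin> D \<and>
     (\<forall>X\<in>D. \<forall>Y\<in>D. X \<inter> Y \<in> D) \<and>
     (\<forall>X\<in>D. \<forall>Y. X \<subseteq> Y \<and> Y \<subseteq> K \<longrightarrow> Y \<in> D) \<and>
     (\<forall>X. X \<subseteq> K \<longrightarrow> X \<in> D \<or> K - X \<in> D)"

definition ueq :: "'k set \<Rightarrow> 'k set set \<Rightarrow> ('k \<Rightarrow> 'a set) \<Rightarrow> (('k \<Rightarrow> 'a) \<times> ('k \<Rightarrow> 'a)) set" where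
  "ueq K D S = {(f, g). f \<in> PiE K S \<and> g \<in> PiE K S \<and> {i\<in>K. f i = g i} \<in> D}"

definition set_ultraprod :: "'k set \<Rightarrow> 'k set set \<Rightarrow> ('k \<Rightarrow> 'a set) \<Rightarrow> ('k \<Rightarrow> 'a) set set" where
  "set_ultraprod K D S = PiE K S // ueq K D S"

definition ucls :: "'k set \<Rightarrow> 'k set set \<Rightarrow> ('k \<Rightarrow> 'a set) \<Rightarrow> ('k \<Rightarrow> 'a) \<Rightarrow> ('k \<Rightarrow> 'a) set" where
  "ucls K D S f = ueq K D S `` {f}"

definition urep :: "('k \<Rightarrow> 'a) set \<Rightarrow> 'k \<Rightarrow> 'a" where
  "urep X = (SOME f. f \<in> X)"

definition ultraprod :: "'k set \<Rightarrow> 'k set set \<Rightarrow> ('k \<Rightarrow> 'a balg) \<Rightarrow> ('k \<Rightarrow> 'a) set balg" where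
  "ultraprod K D A =
    (let S = (\<lambda>i. bcarrier (A i)); cl = ucls K D S in
     \<lparr> bcarrier = set_ultraprod K D S,
       bjoin = (\<lambda>X Y. cl (\<lambda>i\<in>K. bjoin (A i) (urep X i) (urep Y i))),
       bmeet = (\<lambda>X Y. cl (\<lambda>i\<in>K. bmeet (A i) (urep X i) (urep Y i))),
       bcompl = (\<lambda>X. cl (\<lambda>i\<in>K. bcompl (A i) (urep X i))),
       bzero = cl (\<lambda>i\<in>K. bzero (A i)),
       bone = cl (\<lambda>i\<in>K. bone (A i)) \<rparr>)"

end

theory Submission
  imports Defs
begin

text \<open>Let \<open>\<lambda> = |M|\<close> be the \<open>D\<close>-limit of the \<open>\<lambda>\<^sub>i = |L i|\<close>, the least cardinal with \<open>\<lambda>\<^sub>i \<le> \<lambda>\<close> for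
  \<open>D\<close>-almost all \<open>i\<close>. Classes of functions into the \<open>L i\<close> form a dense set, so \<open>\<pi>A\<close> is at most the
  ultraproduct of the \<open>\<lambda>\<^sub>i\<close>. A family of fewer than \<open>\<lambda>\<close> elements of \<open>A\<close> uses fewer than \<open>\<lambda>\<^sub>i\<close> elements
  in almost every coordinate, so it is not dense and \<open>\<lambda> \<le> \<pi>A\<close>. If some \<open>g\<close> with \<open>g i < \<lambda>\<^sub>i\<close> has
  \<open>D\<close>-limit \<open>\<lambda>\<close>, the same diagonalisation with \<open>g i\<close> elements in coordinate \<open>i\<close> defeats even families
  of size \<open>\<lambda>\<close>, so \<open>\<lambda>\<^sup>+ \<le> \<pi>A\<close>, whereas the ultraproduct has size at most \<open>\<lambda>\<^sup>\<kappa> \<le> \<lambda>\<^sup>+\<close> by SCH.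
  Otherwise each element of the ultraproduct is bounded almost everywhere by some \<open>\<alpha> < \<lambda>\<close>, and as
  \<open>|\<alpha>|\<^sup>\<kappa> \<le> \<lambda>\<close> by SCH, the ultraproduct has size at most \<open>\<lambda>\<close>.\<close>

unbundle cardinal_syntax

section \<open>Initial segments of the well-order of a cardinal\<close>

lemma card_of_total:
  assumes "a \<in> M" "b \<in> M"
  shows "(a, b) \<in> |M| \<or> (b, a) \<in> |M|"
  using assms wo_rel.TOTALS[unfolded wo_rel_def, OF card_of_Well_order[of M]]
  by (simp add: Field_card_of)

lemma card_of_trans: "(a, b) \<in> |M| \<Longrightarrow> (b, c) \<in> |M| \<Longrightarrow> (a, c) \<in> |M|"
  using wo_rel.TRANS[unfolded wo_rel_def, OF card_of_Well_order[of M]] by (meson transD)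

lemma card_of_antisym: "(a, b) \<in> |M| \<Longrightarrow> (b, a) \<in> |M| \<Longrightarrow> a = b"
  using wo_rel.ANTISYM[unfolded wo_rel_def, OF card_of_Well_order[of M]] by (meson antisymD)

lemma card_of_cofinal_unbounded:
  assumes "B \<subseteq> M" "\<not> cofinal_in (card_of M) B"
  obtains a where "a \<in> M" "B \<subseteq> underS (card_of M) a"
proof -
  obtain a where a: "a \<in> M" "\<forall>b\<in>B. (a, b) \<notin> |M|"
    using assms by (auto simp: cofinal_in_def Field_card_of)
  have "B \<subseteq> underS (card_of M) a"
    using a assms(1) card_of_total[of _ M a] by (fastforce simp: underS_def)
  with a(1) show ?thesis using that by blast
qed

text \<open>An infinite cardinal is a limit ordinal, so a closed segment lies inside a proper open
  one, and those are smaller because the ordinal is initial.\<close>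

lemma card_of_under_less:
  assumes "infinite M" "a \<in> M"
  shows "|under (card_of M) a| <o |M|"
proof -
  obtain b where b: "b \<in> M" "a \<noteq> b" "(a, b) \<in> |M|"
    using infinite_Card_order_limit[OF card_of_Card_order, of M a] assms
    by (auto simp: Field_card_of)
  have "under (card_of M) a \<subseteq> underS (card_of M) b"
    using b card_of_trans[of _ a M b] card_of_antisym[of a b M]
    by (auto simp: under_def underS_def)
  moreover have "|underS (card_of M) b| <o |M|"
    using card_of_underS[OF card_of_Card_order] b(1) by (metis Field_card_of)
  ultimately show ?thesis
    using card_of_mono1 ordLeq_ordLess_trans by blast
qed

section \<open>Cardinal exponentiation under SCH\<close>

lemma card_of_Func_eq_cexp: "|Func K M| = |M| ^c |K|"
  by (simp add: cexp_def Field_card_of)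

lemma card_of_Func_mono:
  assumes "|M| \<le>o |N|"
  shows "|Func K M| \<le>o |Func K N|"
  unfolding card_of_Func_eq_cexp by (rule cexp_mono1[OF assms card_of_Card_order])

text \<open>Because \<open>(2^|K|)^|K| = 2^(|K| * |K|) = 2^|K|\<close> for infinite
  \<open>K\<close>.\<close>

lemma card_of_Func_le_Pow:
  assumes "infinite K" "|M| \<le>o |Pow K|"
  shows "|Func K M| \<le>o |Pow K|"
proof -
  have pow: "|Pow K| =o |Func K (UNIV :: bool set)|"
    by (rule card_of_Pow_Func)
  have "|Func K M| \<le>o |Func K (Func K (UNIV :: bool set))|"
    using assms(2) pow ordLeq_ordIso_trans card_of_Func_mono by blast
  also have "|Func K (Func K (UNIV :: bool set))| =o |Func K (UNIV :: bool set)|"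
    unfolding card_of_Func_eq_cexp
    by (rule cexp_cprod_ordLeq)
      (use assms in \<open>auto simp: card_of_card_order_on ctwo_def cinfinite_def Field_card_of
        card_of_ordIso_czero_iff_empty         intro!: ordLeq_refl[OF card_of_Card_order]\<close>)
  finally show ?thesis
    using pow ordIso_symmetric ordLeq_ordIso_trans by blast
qed

lemma finite_Func:
  assumes "finite K" "finite M"
  shows "finite (Func K M)"
proof -
  have "Func K M = {f. \<forall>x. (x \<in> K \<longrightarrow> f x \<in> M) \<and> (x \<notin> K \<longrightarrow> f x = undefined)}"
    by (auto simp: Func_def)
  then show ?thesis using finite_set_of_finite_funs[OF assms] by simp
qed

text \<open>For infinite \<open>N\<close> above \<open>|Pow K|\<close>, \<open>IH\<close> gives
  \<open>|N|^|K| \<le> |N|^+ \<le> |M|\<close>; for \<open>N\<close> at most \<open>|Pow K|\<close>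
  with \<open>K\<close> infinite, \<open>|N|^|K| \<le> 2^|K| < |M|\<close>; otherwise
  \<open>Func K N\<close> is finite. With \<open>IH\<close> as a premise the lemma serves both the
  induction below and the final theorem.\<close>

lemma card_of_Func_le_of_smaller:
  fixes M N :: "'a set" and K :: "'k set"
  assumes IH: "infinite N \<Longrightarrow> |Pow K| <o |N| \<Longrightarrow> |Func K N| \<le>o cardSuc (card_of N)"
    and M: "infinite M" "|Pow K| <o |M|" and N: "|N| <o |M|"
  shows "|Func K N| \<le>o |M|"
proof (cases "|Pow K| <o |N|")
  case True
  show ?thesis
  proof (cases "finite N")
    case True
    then have "finite (Pow K)"
      using \<open>|Pow K| <o |N|\<close> card_of_ordLeq_finite ordLess_imp_ordLeq by blast
    then have "finite (Func K N)"
      using finite_Func True by auto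
    then show ?thesis
      using M(1) ordLess_imp_ordLeq finite_ordLess_infinite[OF card_of_Well_order card_of_Well_order]
      by (metis Field_card_of)
  next
    case False
    then show ?thesis
      using IH True N cardSuc_ordLess_ordLeq[OF card_of_Card_order card_of_Card_order]
        ordLeq_transitive by blast
  qed
next
  case False
  then have le: "|N| \<le>o |Pow K|"
    by (simp add: not_ordLess_iff_ordLeq[OF card_of_Well_order card_of_Well_order])
  show ?thesis
  proof (cases "finite K")
    case True
    then have "finite N"
      using le card_of_ordLeq_finite by blast
    then have "finite (Func K N)"
      using finite_Func True by auto
    then show ?thesis
      using M(1) ordLess_imp_ordLeq finite_ordLess_infinite[OF card_of_Well_order card_of_Well_order]
      by (metis Field_card_of)
  next
    case False
    then show ?thesis
      using card_of_Func_le_Pow[OF False le] M(2) ordLeq_ordLess_trans ordLess_imp_ordLeq by blast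
  qed
qed

text \<open>Induction on \<open>|M|\<close>. If \<open>cf |M| > |K|\<close>, every function is bounded. Otherwise a function is
  determined by its truncations at the points of a least cofinal \<open>C\<close>, so
  \<open>|Func K M| \<le> |Func C M|\<close>, to which SCH applies.\<close>

lemma sch_card_of_Func:
  fixes M :: "'u set" and K :: "'k set"
  assumes sch: "SCH TYPE('u)"
  shows "infinite M \<Longrightarrow> |Pow K| <o |M| \<Longrightarrow> |Func K M| \<le>o cardSuc (card_of M)"
proof (induction M rule: wf_induct[OF wf_inv_image[OF wf_ordLess, of card_of]])
  case (1 M)
  note M = 1(2,3)
  have small: "|Func K N| \<le>o |M|" if "|N| <o |M|" for N :: "'u set"
    using 1 that by (intro card_of_Func_le_of_smaller) (auto simp: inv_image_def)
  have suc: "|M| \<le>o cardSuc (card_of M)"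
    by (rule cardSuc_ordLeq[OF card_of_Card_order])
  show ?case
  proof (cases "\<exists>C. cofinal_in (card_of M) C \<and> |C| \<le>o |K|")
    case False
    have "Func K M \<subseteq> (\<Union>a\<in>M. Func K (underS (card_of M) a))"
    proof
      fix f assume f: "f \<in> Func K M"
      then have "f ` K \<subseteq> M" by (auto simp: Func_def)
      moreover have "\<not> cofinal_in (card_of M) (f ` K)"
        using False card_of_image by blast
      ultimately obtain a where "a \<in> M" "f ` K \<subseteq> underS (card_of M) a"
        by (rule card_of_cofinal_unbounded)
      with f show "f \<in> (\<Union>a\<in>M. Func K (underS (card_of M) a))"
        by (auto simp: Func_def)
    qed
    moreover have "|\<Union>a\<in>M. Func K (underS (card_of M) a)| \<le>o |M|"
      using card_of_underS[OF card_of_Card_order, of _ M]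
      by (intro card_of_UNION_ordLeq_infinite[OF M(1) ordLeq_refl[OF card_of_Card_order]] ballI small)
        (simp add: Field_card_of)
    ultimately show ?thesis
      by (rule ordLeq_transitive[OF ordLeq_transitive[OF card_of_mono1] suc])
  next
    case True
    \<comment> \<open>Cardinals being well-ordered, some cofinal \<open>C\<close> has least size; as
      it is no larger than \<open>K\<close>, it satisfies the premise of SCH.\<close>
    have "\<exists>r \<in> card_of ` {C. cofinal_in (card_of M) C}. \<forall>r' \<in> card_of ` {C. cofinal_in (card_of M) C}. r \<le>o r'"
      using True by (intro exists_minim_Card_order) (auto simp: card_of_Card_order)
    then obtain C where C: "cofinal_in (card_of M) C" "\<And>C'. cofinal_in (card_of M) C' \<Longrightarrow> |C| \<le>o |C'|"
      by blast
    then have min: "min_cofinal M C"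
      unfolding min_cofinal_def by blast
    have CK: "|C| \<le>o |K|"
      using True C(2) ordLeq_transitive[of "|C|"] by blast
    then obtain h where h: "inj_on h C" "h ` C \<subseteq> K"
      unfolding card_of_ordLeq[symmetric] by blast
    have "|Pow C| \<le>o |Pow K|"
      using h by (intro card_of_ordLeqI[of "image h"] inj_on_image_Pow) auto
    then have "|Pow C| <o |M|"
      by (rule ordLeq_ordLess_trans[OF _ M(2)])
    then have FC: "|Func C M| =o cardSuc (card_of M)"
      using sch min M(1) by (simp add: SCH_def)
    have CM: "C \<subseteq> M"
      using C(1) by (simp add: cofinal_in_def Field_card_of)
    \<comment> \<open>Truncations at \<open>c\<close> take values in a smaller set, so by
      \<open>small\<close> each can be coded by one element of \<open>M\<close>.\<close>
    have "\<exists>e. inj_on e (Func K (under (card_of M) c)) \<and> e ` Func K (under (card_of M) c) \<subseteq> M" if "c \<in> C" for c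
      unfolding card_of_ordLeq using small card_of_under_less[OF M(1)] CM that by blast
    then obtain e where e: "\<And>c. c \<in> C \<Longrightarrow> inj_on (e c) (Func K (under (card_of M) c))"
      "\<And>c. c \<in> C \<Longrightarrow> e c ` Func K (under (card_of M) c) \<subseteq> M"
      by metis
    \<comment> \<open>On \<open>K\<close> this is the pointwise minimum of \<open>f\<close> and
      \<open>c\<close> in the order \<open>|M|\<close>.\<close>
    define t where "t c f = (\<lambda>k. if k \<in> K then (if (f k, c) \<in> |M| then f k else c) else undefined)"
      for c and f :: "'k \<Rightarrow> 'u"
    have refl: "(c, c) \<in> |M|" if "c \<in> M" for c
      using card_of_total[OF that that] by simp
    have t: "t c f \<in> Func K (under (card_of M) c)" if "c \<in> C" for c f
      using that CM refl by (auto simp: t_def Func_def under_def)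
    define F where "F f = (\<lambda>c. if c \<in> C then e c (t c f) else undefined)" for f
    have "|Func K M| \<le>o |Func C M|"
    proof (rule card_of_ordLeqI[of F])
      show "F f \<in> Func C M" if "f \<in> Func K M" for f
        using e(2) t by (fastforce simp: F_def Func_def)
      show "inj_on F (Func K M)"
      proof (rule inj_onI)
        fix f g assume f: "f \<in> Func K M" and g: "g \<in> Func K M" and "F f = F g"
        then have eq: "t c f = t c g" if "c \<in> C" for c
          using that e(1) t by (metis F_def inj_onD)
        show "f = g"
        proof
          fix k
          show "f k = g k"
          proof (cases "k \<in> K")
            case True
            then have "f k \<in> M" "g k \<in> M" using f g by (auto simp: Func_def)
            \<comment> \<open>Truncation at a point of \<open>C\<close> above both values leaves
              them unchanged, so they agree.\<close>
            then obtain m where m: "m \<in> M" "(f k, m) \<in> |M|" "(g k, m) \<in> |M|"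
              using card_of_total refl by metis
            obtain c where c: "c \<in> C" "(m, c) \<in> |M|"
              using C(1) m(1) by (auto simp: cofinal_in_def Field_card_of)
            have "(f k, c) \<in> |M|" "(g k, c) \<in> |M|"
              using m c(2) card_of_trans by metis+
            then show ?thesis
              using eq[OF c(1), THEN fun_cong, of k] True by (simp add: t_def)
          qed (use f g in \<open>auto simp: Func_def\<close>)
        qed
      qed
    qed
    then show ?thesis
      using FC ordLeq_ordIso_trans by blast
  qed
qed

text \<open>The theorem assumes SCH for the type of ultraproduct classes, whereas its cardinals are
  sets over \<open>'a\<close>; the bound is pulled back along an embedding of types.\<close>

lemma sch_card_of_Func_inj:
  fixes h :: "'a \<Rightarrow> 'u" and M :: "'a set" and K :: "'k set"
  assumes sch: "SCH TYPE('u)" and h: "inj h"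
    and M: "infinite M" "|Pow K| <o |M|"
  shows "|Func K M| \<le>o cardSuc (card_of M)"
proof -
  have iso: "|M| =o |h ` M|"
    using h by (intro card_of_ordIsoI[of h]) (simp add: bij_betw_def inj_on_def)
  have "|Func K M| \<le>o |Func K (h ` M)|"
    by (rule card_of_Func_mono[OF ordIso_imp_ordLeq[OF iso]])
  also have "|Func K (h ` M)| \<le>o cardSuc (card_of (h ` M))"
    using sch_card_of_Func[OF sch] iso M card_of_ordIso_finite ordLess_ordIso_trans by blast
  also have "cardSuc (card_of (h ` M)) =o cardSuc (card_of M)"
    using cardSuc_invar_ordIso[OF card_of_Card_order card_of_Card_order] iso ordIso_symmetric by blast
  finally show ?thesis .
qed

section \<open>Ultrafilters and ultraproducts of sets\<close>

locale ultra =
  fixes K :: "'k set" and D :: "'k set set"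
  assumes D: "ultrafilter_on K D"
begin

abbreviation ae :: "('k \<Rightarrow> bool) \<Rightarrow> bool" where
  "ae P \<equiv> {i\<in>K. P i} \<in> D"

lemma ae_mono:
  assumes "ae P" "\<And>i. i \<in> K \<Longrightarrow> P i \<Longrightarrow> Q i"
  shows "ae Q"
proof -
  have "{i\<in>K. P i} \<subseteq> {i\<in>K. Q i} \<and> {i\<in>K. Q i} \<subseteq> K"
    using assms(2) by blast
  then show ?thesis
    using D assms(1) unfolding ultrafilter_on_def by blast
qed

lemma ae_conj:
  assumes "ae P" "ae Q"
  shows "ae (\<lambda>i. P i \<and> Q i)"
proof -
  have "{i\<in>K. P i} \<inter> {i\<in>K. Q i} \<in> D"
    using D assms unfolding ultrafilter_on_def by blast
  also have "{i\<in>K. P i} \<inter> {i\<in>K. Q i} = {i\<in>K. P i \<and> Q i}"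
    by blast
  finally show ?thesis .
qed

lemma ae_not:
  assumes "\<not> ae P"
  shows "ae (\<lambda>i. \<not> P i)"
proof -
  have "{i\<in>K. P i} \<subseteq> K \<longrightarrow> {i\<in>K. P i} \<in> D \<or> K - {i\<in>K. P i} \<in> D"
    using D unfolding ultrafilter_on_def by (elim conjE) (erule spec)
  then have "K - {i\<in>K. P i} \<in> D"
    using assms by auto
  also have "K - {i\<in>K. P i} = {i\<in>K. \<not> P i}"
    by blast
  finally show ?thesis .
qed

text \<open>Several contradictions below come from here: finitely many properties that hold almost
  everywhere meet in one coordinate.\<close>

lemma ae_ex:
  assumes "ae P"
  obtains i where "i \<in> K" "P i"
proof -
  have "{i\<in>K. P i} \<noteq> {}"
    using D assms unfolding ultrafilter_on_def by metis
  then show ?thesis using that by auto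
qed

lemma ae_all: "(\<And>i. i \<in> K \<Longrightarrow> P i) \<Longrightarrow> ae P"
proof -
  assume "\<And>i. i \<in> K \<Longrightarrow> P i"
  then have "{i\<in>K. P i} = K" by blast
  then show ?thesis using D by (simp add: ultrafilter_on_def)
qed

lemma equiv_ueq: "equiv (PiE K S) (ueq K D S)"
proof (rule equivI)
  show "ueq K D S \<subseteq> PiE K S \<times> PiE K S" by (auto simp: ueq_def)
  show "refl_on (PiE K S) (ueq K D S)"
    using D by (intro refl_onI) (simp add: ueq_def ultrafilter_on_def)
  show "sym (ueq K D S)"
    by (rule symI) (auto simp: ueq_def eq_commute)
  show "trans (ueq K D S)"
  proof (rule transI)
    fix f g h assume "(f, g) \<in> ueq K D S" "(g, h) \<in> ueq K D S"
    moreover from this have "ae (\<lambda>i. f i = g i \<and> g i = h i)"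
      by (intro ae_conj) (auto simp: ueq_def)
    then have "ae (\<lambda>i. f i = h i)"
      by (rule ae_mono) simp
    ultimately show "(f, h) \<in> ueq K D S"
      by (simp add: ueq_def)
  qed
qed

lemma ucls_in_ultraprod: "f \<in> PiE K S \<Longrightarrow> ucls K D S f \<in> set_ultraprod K D S"
  by (auto simp: ucls_def set_ultraprod_def intro: quotientI)

lemma ucls_eq_iff:
  "f \<in> PiE K S \<Longrightarrow> g \<in> PiE K S \<Longrightarrow> ucls K D S f = ucls K D S g \<longleftrightarrow> ae (\<lambda>i. f i = g i)"
  using eq_equiv_class_iff[OF equiv_ueq, of f S g] by (simp add: ucls_def ueq_def)

lemma
  assumes "X \<in> set_ultraprod K D S"
  shows urep_in_PiE: "urep X \<in> PiE K S" and ucls_urep: "ucls K D S (urep X) = X"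
proof -
  obtain f where f: "f \<in> PiE K S" "X = ueq K D S `` {f}"
    using assms by (auto simp: set_ultraprod_def elim: quotientE)
  then have "f \<in> X"
    using equiv_class_self[OF equiv_ueq] by blast
  then have "urep X \<in> X"
    unfolding urep_def by (rule someI[of "\<lambda>f. f \<in> X"])
  then show "urep X \<in> PiE K S" "ucls K D S (urep X) = X"
    using f equiv_class_eq[OF equiv_ueq, of f "urep X" S] by (auto simp: ucls_def ueq_def)
qed

text \<open>\<open>urep\<close> chooses an arbitrary member of the class, so it recovers
  \<open>f\<close> only up to a set outside \<open>D\<close>.\<close>

lemma ae_urep_ucls: "f \<in> PiE K S \<Longrightarrow> ae (\<lambda>i. urep (ucls K D S f) i = f i)"
  using ucls_eq_iff[OF urep_in_PiE[OF ucls_in_ultraprod], of f S f] ucls_urep[OF ucls_in_ultraprod, of f S]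
  by simp

lemma ultraprod_eqI:
  assumes "X \<in> set_ultraprod K D S" "Y \<in> set_ultraprod K D S" "ae (\<lambda>i. urep X i = urep Y i)"
  shows "X = Y"
  using iffD2[OF ucls_eq_iff[OF urep_in_PiE urep_in_PiE] assms(3)] assms(1,2)
  by (simp add: ucls_urep)

section \<open>Dense sets in Boolean algebras and in their ultraproduct\<close>

lemma bcarrier_ultraprod: "bcarrier (ultraprod K D A) = set_ultraprod K D (\<lambda>i. bcarrier (A i))"
  by (simp add: ultraprod_def Let_def)

lemma bzero_ultraprod:
  "bzero (ultraprod K D A) = ucls K D (\<lambda>i. bcarrier (A i)) (\<lambda>i\<in>K. bzero (A i))"
  by (simp add: ultraprod_def Let_def)

lemma bzero_PiE:
  "\<forall>i\<in>K. boolean_algebra (A i) \<Longrightarrow> (\<lambda>i\<in>K. bzero (A i)) \<in> PiE K (\<lambda>i. bcarrier (A i))"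
  by (auto simp: boolean_algebra_def)

text \<open>Los's theorem for \<open>x = 0\<close>; the next lemma is the case
  \<open>x \<le> y\<close>. Density is expressed through these two relations.\<close>

lemma eq_bzero_ultraprod_iff:
  assumes "\<forall>i\<in>K. boolean_algebra (A i)" "X \<in> bcarrier (ultraprod K D A)"
  shows "X = bzero (ultraprod K D A) \<longleftrightarrow> ae (\<lambda>i. urep X i = bzero (A i))"
proof -
  let ?S = "\<lambda>i. bcarrier (A i)"
  have X: "X \<in> set_ultraprod K D ?S"
    using assms(2) by (simp add: bcarrier_ultraprod)
  have "X = bzero (ultraprod K D A) \<longleftrightarrow> ucls K D ?S (urep X) = ucls K D ?S (\<lambda>i\<in>K. bzero (A i))"
    by (simp add: bzero_ultraprod ucls_urep[OF X])
  also have "\<dots> \<longleftrightarrow> ae (\<lambda>i. urep X i = (\<lambda>i\<in>K. bzero (A i)) i)"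
    by (rule ucls_eq_iff[OF urep_in_PiE[OF X] bzero_PiE[OF assms(1)]])
  also have "{i\<in>K. urep X i = (\<lambda>i\<in>K. bzero (A i)) i} = {i\<in>K. urep X i = bzero (A i)}"
    by auto
  finally show ?thesis .
qed

lemma ble_ultraprod_iff:
  assumes BA: "\<forall>i\<in>K. boolean_algebra (A i)"
    and XY: "X \<in> bcarrier (ultraprod K D A)" "Y \<in> bcarrier (ultraprod K D A)"
  shows "ble (ultraprod K D A) X Y \<longleftrightarrow> ae (\<lambda>i. ble (A i) (urep X i) (urep Y i))"
proof -
  let ?S = "\<lambda>i. bcarrier (A i)"
  let ?m = "\<lambda>i\<in>K. bmeet (A i) (urep X i) (urep Y i)"
  have X: "urep X \<in> PiE K ?S" and Y: "urep Y \<in> PiE K ?S"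
    using XY urep_in_PiE unfolding bcarrier_ultraprod by blast+
  have m: "?m \<in> PiE K ?S"
    using BA PiE_mem[OF X] PiE_mem[OF Y] by (auto simp: boolean_algebra_def)
  have "ble (ultraprod K D A) X Y \<longleftrightarrow> ucls K D ?S ?m = ucls K D ?S (urep X)"
    using ucls_urep[of X ?S] XY(1)[unfolded bcarrier_ultraprod]
    by (simp add: ble_def ultraprod_def Let_def)
  also have "\<dots> \<longleftrightarrow> ae (\<lambda>i. ?m i = urep X i)"
    by (rule ucls_eq_iff[OF m X])
  also have "{i\<in>K. ?m i = urep X i} = {i\<in>K. ble (A i) (urep X i) (urep Y i)}"
    by (auto simp: ble_def)
  finally show ?thesis .
qed

text \<open>Below a nonzero class, choose in almost every coordinate a member of \<open>L i\<close>
  below its representative; the Los equivalences carry this to the classes.\<close>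

lemma dense_set_ultraprod:
  assumes BA: "\<forall>i\<in>K. boolean_algebra (A i)" and L: "\<forall>i\<in>K. dense_set (A i) (L i) \<and> L i \<noteq> {}"
  shows "dense_set (ultraprod K D A) (ucls K D (\<lambda>i. bcarrier (A i)) ` PiE K L)"
  unfolding dense_set_def
proof (intro conjI ballI subsetI)
  let ?S = "\<lambda>i. bcarrier (A i)"
  have S: "f \<in> PiE K ?S" if "f \<in> PiE K L" for f
    using L that by (fastforce simp: dense_set_def PiE_iff)
  have mem: "ucls K D ?S f \<in> bcarrier (ultraprod K D A) - {bzero (ultraprod K D A)}"
    if f: "f \<in> PiE K L" for f
  proof -
    have c: "ucls K D ?S f \<in> bcarrier (ultraprod K D A)"
      using ucls_in_ultraprod[OF S[OF f]] by (simp add: bcarrier_ultraprod)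
    have "\<not> ae (\<lambda>i. urep (ucls K D ?S f) i = bzero (A i))"
    proof
      assume "ae (\<lambda>i. urep (ucls K D ?S f) i = bzero (A i))"
      from ae_conj[OF this ae_urep_ucls[OF S[OF f]]] obtain i where i: "i \<in> K"
        "urep (ucls K D ?S f) i = bzero (A i) \<and> urep (ucls K D ?S f) i = f i"
        by (rule ae_ex)
      then have "bzero (A i) \<in> L i"
        using PiE_mem[OF f] by metis
      then show False
        using L i(1) by (auto simp: dense_set_def)
    qed
    with c show ?thesis
      using eq_bzero_ultraprod_iff[OF BA c] by blast
  qed
  show "x \<in> bcarrier (ultraprod K D A) - {bzero (ultraprod K D A)}"
    if "x \<in> ucls K D ?S ` PiE K L" for x
    using that mem by blast
  show "\<exists>x\<in>ucls K D ?S ` PiE K L. ble (ultraprod K D A) x a"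
    if a: "a \<in> bcarrier (ultraprod K D A) - {bzero (ultraprod K D A)}" for a
  proof -
    have ua: "urep a \<in> PiE K ?S"
      using a urep_in_PiE by (auto simp: bcarrier_ultraprod)
    have nz: "ae (\<lambda>i. urep a i \<noteq> bzero (A i))"
      using a eq_bzero_ultraprod_iff[OF BA, of a] by (intro ae_not) blast
    \<comment> \<open>Where the representative happens to be zero any member of \<open>L i\<close>
      serves, so the choice is total on \<open>K\<close>.\<close>
    have "\<exists>x\<in>L i. urep a i \<noteq> bzero (A i) \<longrightarrow> ble (A i) x (urep a i)" if i: "i \<in> K" for i
    proof (cases "urep a i = bzero (A i)")
      case True
      then show ?thesis using L i by auto
    next
      case False
      then show ?thesis using L i PiE_mem[OF ua i] by (auto simp: dense_set_def)
    qed
    then obtain f where f: "\<forall>i\<in>K. f i \<in> L i \<and> (urep a i \<noteq> bzero (A i) \<longrightarrow> ble (A i) (f i) (urep a i))"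
      by metis
    then have fL: "restrict f K \<in> PiE K L" by auto
    let ?x = "ucls K D ?S (restrict f K)"
    have "ae (\<lambda>i. ble (A i) (urep ?x i) (urep a i))"
      using ae_conj[OF nz ae_urep_ucls[OF S[OF fL]]] by (rule ae_mono) (simp add: f)
    then have "ble (ultraprod K D A) ?x a"
      using mem[OF fL] a by (subst ble_ultraprod_iff[OF BA]) auto
    then show ?thesis
      using fL by (intro bexI[of _ ?x] imageI)
  qed
qed

text \<open>Diagonalisation: choose in almost every coordinate a nonzero element that is above no
  coordinate of a member of \<open>Z i\<close>.\<close>

lemma not_dense_set_ultraprod:
  assumes BA: "\<forall>i\<in>K. boolean_algebra (A i)" and L: "\<forall>i\<in>K. min_dense_set (A i) (L i)"
    and Z: "ae (\<lambda>i. |Z i| <o |L i| )" "\<And>y. y \<in> Y \<Longrightarrow> ae (\<lambda>i. y \<in> Z i)"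
  shows "\<not> dense_set (ultraprod K D A) Y"
proof
  assume Y: "dense_set (ultraprod K D A) Y"
  let ?S = "\<lambda>i. bcarrier (A i)"
  have "\<exists>a\<in>bcarrier (A i). |Z i| <o |L i| \<longrightarrow> a \<noteq> bzero (A i) \<and>
    (\<forall>y\<in>Z i. urep y i \<in> bcarrier (A i) - {bzero (A i)} \<longrightarrow> \<not> ble (A i) (urep y i) a)" if i: "i \<in> K" for i
  proof (cases "|Z i| <o |L i|")
    case True
    \<comment> \<open>Zero coordinates are discarded, so \<open>?W\<close> can fail to be dense only
      through a nonzero element above none of its members. It does fail, being smaller than the
      least dense set \<open>L i\<close>.\<close>
    let ?W = "(\<lambda>y. urep y i) ` Z i \<inter> (bcarrier (A i) - {bzero (A i)})"
    have "|?W| \<le>o |Z i|"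
      by (rule ordLeq_transitive[OF card_of_mono1 card_of_image]) blast
    then have "|?W| <o |L i|"
      using True by (rule ordLeq_ordLess_trans)
    then have "\<not> dense_set (A i) ?W"
      using L i not_ordLess_ordLeq unfolding min_dense_set_def by blast
    then show ?thesis
      unfolding dense_set_def by blast
  next
    case False
    then show ?thesis
      using BA i unfolding boolean_algebra_def by blast
  qed
  then obtain a where a: "\<And>i. i \<in> K \<Longrightarrow> a i \<in> bcarrier (A i)"
    "\<And>i. i \<in> K \<Longrightarrow> |Z i| <o |L i| \<Longrightarrow> a i \<noteq> bzero (A i)"
    "\<And>i y. i \<in> K \<Longrightarrow> |Z i| <o |L i| \<Longrightarrow> y \<in> Z i \<Longrightarrow>
      urep y i \<in> bcarrier (A i) - {bzero (A i)} \<Longrightarrow> \<not> ble (A i) (urep y i) (a i)"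
    by metis
  have aS: "restrict a K \<in> PiE K ?S" using a(1) by auto
  let ?x = "ucls K D ?S (restrict a K)"
  have x: "?x \<in> bcarrier (ultraprod K D A)"
    using ucls_in_ultraprod[OF aS] by (simp add: bcarrier_ultraprod)
  have xa: "ae (\<lambda>i. urep ?x i = a i)"
    by (rule ae_mono[OF ae_urep_ucls[OF aS]]) auto
  have "\<not> ae (\<lambda>i. urep ?x i = bzero (A i))"
  proof
    assume "ae (\<lambda>i. urep ?x i = bzero (A i))"
    from ae_conj[OF ae_conj[OF this xa] Z(1)] obtain i where "i \<in> K"
      "(urep ?x i = bzero (A i) \<and> urep ?x i = a i) \<and> |Z i| <o |L i|"
      by (rule ae_ex)
    then show False using a(2)[of i] by auto
  qed
  then have "?x \<in> bcarrier (ultraprod K D A) - {bzero (ultraprod K D A)}"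
    using eq_bzero_ultraprod_iff[OF BA x] x by blast
  then obtain y where y: "y \<in> Y" "ble (ultraprod K D A) y ?x"
    using Y unfolding dense_set_def by blast
  then have yc: "y \<in> bcarrier (ultraprod K D A)" "y \<noteq> bzero (ultraprod K D A)"
    using Y unfolding dense_set_def by blast+
  have nz: "ae (\<lambda>i. urep y i \<noteq> bzero (A i))"
    using yc eq_bzero_ultraprod_iff[OF BA yc(1)] by (intro ae_not) blast
  have le: "ae (\<lambda>i. ble (A i) (urep y i) (urep ?x i))"
    using y(2) ble_ultraprod_iff[OF BA yc(1) x] by blast
  \<comment> \<open>In one coordinate \<open>y\<close> is nonzero, belongs to \<open>Z i\<close> and
    lies below \<open>a i\<close>, against the choice of \<open>a\<close>.\<close>
  from ae_conj[OF nz ae_conj[OF le ae_conj[OF xa ae_conj[OF Z(2)[OF y(1)] Z(1)]]]]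
  obtain i where i: "i \<in> K" "urep y i \<noteq> bzero (A i) \<and> ble (A i) (urep y i) (urep ?x i) \<and>
      urep ?x i = a i \<and> y \<in> Z i \<and> |Z i| <o |L i|"
    by (rule ae_ex)
  have "urep y i \<in> bcarrier (A i)"
    using yc(1) by (intro PiE_mem[OF urep_in_PiE i(1)]) (simp add: bcarrier_ultraprod)
  then have "\<not> ble (A i) (urep y i) (a i)"
    using i by (intro a(3)) auto
  then show False
    using i(2) by metis
qed

end

text \<open>An element is determined by the members of \<open>X\<close> below it, so the carrier
  injects into \<open>Pow X\<close>.\<close>

lemma infinite_dense_set:
  assumes B: "boolean_algebra B" and inf: "infinite (bcarrier B)" and X: "dense_set B X"
  shows "infinite X"
proof
  assume "finite X"
  let ?C = "bcarrier B"
  note BA = B[unfolded boolean_algebra_def]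
  have mC: "bmeet B x y \<in> ?C" and comm: "bmeet B x y = bmeet B y x" if "x \<in> ?C" "y \<in> ?C" for x y
    using BA that by blast+
  have cC: "bcompl B x \<in> ?C" and cm: "bmeet B x (bcompl B x) = bzero B" if "x \<in> ?C" for x
    using BA that by blast+
  have assoc: "bmeet B (bmeet B x y) z = bmeet B x (bmeet B y z)" if "x \<in> ?C" "y \<in> ?C" "z \<in> ?C" for x y z
    using BA that by metis
  have idem: "bmeet B x x = x" if "x \<in> ?C" for x
    using BA that by metis
  have zero: "bmeet B x (bzero B) = bzero B" if "x \<in> ?C" for x
    using that assoc[OF that that cC[OF that]] by (simp add: cm idem)
  \<comment> \<open>If \<open>?d\<close>, the part of \<open>a\<close> outside \<open>b\<close>, is
    nonzero, some \<open>x\<close> in \<open>X\<close> is below it; then \<open>x\<close> is below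
    \<open>a\<close>, hence below \<open>b\<close> by \<open>sub\<close>, and also below the
    complement of \<open>b\<close>, so it is zero.\<close>
  have le: "ble B a b" if ab: "a \<in> ?C" "b \<in> ?C" and sub: "{x\<in>X. ble B x a} \<subseteq> {x\<in>X. ble B x b}" for a b
  proof -
    let ?d = "bmeet B a (bcompl B b)"
    have d: "?d \<in> ?C" using ab mC cC by blast
    have "?d = bzero B"
    proof (rule ccontr)
      assume "?d \<noteq> bzero B"
      then obtain x where x: "x \<in> X" "bmeet B x ?d = x"
        using X d unfolding dense_set_def ble_def by blast
      then have xC: "x \<in> ?C" and x0: "x \<noteq> bzero B"
        using X unfolding dense_set_def by blast+
      have "bmeet B x a = bmeet B (bmeet B x ?d) a"
        by (simp add: x(2))
      also have "\<dots> = bmeet B x (bmeet B a ?d)"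
        using assoc[OF xC d ab(1)] comm[OF d ab(1)] by simp
      also have "bmeet B a ?d = ?d"
        using assoc[OF ab(1,1) cC[OF ab(2)]] idem[OF ab(1)] by simp
      finally have "bmeet B x b = x"
        using x sub unfolding ble_def by auto
      then have "x = bmeet B (bmeet B x b) ?d"
        by (simp add: x(2))
      also have "\<dots> = bmeet B x (bmeet B (bmeet B a (bcompl B b)) b)"
        using assoc[OF xC ab(2) d] comm[OF ab(2) d] by simp
      also have "\<dots> = bmeet B x (bmeet B a (bzero B))"
        using assoc[OF ab(1) cC[OF ab(2)] ab(2)] comm[OF ab(2) cC[OF ab(2)]] cm[OF ab(2)] by simp
      finally show False
        using zero[OF ab(1)] zero[OF xC] x0 by simp
    qed
    \<comment> \<open>Distributivity splits \<open>a\<close> into \<open>bmeet B a b\<close> and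
      \<open>?d\<close>, so a vanishing \<open>?d\<close> puts \<open>a\<close> below
      \<open>b\<close>.\<close>
    moreover have "a = bmeet B a (bjoin B b (bcompl B b))" "bmeet B a (bjoin B b (bcompl B b)) = bjoin B (bmeet B a b) ?d"
      "bjoin B (bmeet B a b) (bzero B) = bmeet B a b"
      using BA ab mC[OF ab] cC by metis+
    ultimately show ?thesis
      unfolding ble_def by metis
  qed
  have "inj_on (\<lambda>a. {x\<in>X. ble B x a}) ?C"
  proof (rule inj_onI)
    fix a b assume ab: "a \<in> ?C" "b \<in> ?C" "{x\<in>X. ble B x a} = {x\<in>X. ble B x b}"
    then have "bmeet B a b = a" "bmeet B b a = b"
      using le[of a b] le[of b a] unfolding ble_def by auto
    then show "a = b" using comm[OF ab(1,2)] by simp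
  qed
  moreover have "(\<lambda>a. {x\<in>X. ble B x a}) ` ?C \<subseteq> Pow X" by blast
  ultimately have "finite ?C"
    using \<open>finite X\<close> by (meson finite_Pow_iff inj_on_finite)
  with inf show False by simp
qed

section \<open>Upper bounds for ultraproducts of sets\<close>

lemma initial_segment_embedding:
  assumes "|A| \<le>o |B|"
  obtains e where "inj_on e A" "e ` A \<subseteq> B" "\<And>x. x \<in> A \<Longrightarrow> |underS (card_of B) (e x)| <o |A|"
proof -
  obtain e where e: "embed (card_of A) (card_of B) e"
    using assms unfolding ordLeq_def by blast
  show thesis
  proof (rule that)
    show "inj_on e A"
      using embed_inj_on[OF card_of_Well_order e] by (simp add: Field_card_of)
    show "e ` A \<subseteq> B"
      using embed_Field[OF e] by (simp add: Field_card_of)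
    fix x assume "x \<in> A"
    then have x: "x \<in> Field (card_of A)" by (simp add: Field_card_of)
    \<comment> \<open>An embedding of well-orders carries the predecessors of \<open>x\<close> onto
      those of \<open>e x\<close>, and a point of an initial ordinal has fewer predecessors than the
      ordinal has elements.\<close>
    have "|underS (card_of A) x| =o |underS (card_of B) (e x)|"
      by (rule card_of_ordIsoI[OF embed_underS[OF card_of_Well_order e x]])
    then show "|underS (card_of B) (e x)| <o |A|"
      using card_of_underS[OF card_of_Card_order x] by (meson ordIso_ordLess_trans ordIso_symmetric)
  qed
qed

context ultra
begin

text \<open>A class is coded by its representative, injected coordinatewise into \<open>M\<close>;
  \<open>m\<close> fills the coordinates where \<open>L i\<close> does not fit, a set outside
  \<open>D\<close>.\<close>

lemma card_of_ultraprod_le_Func: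
  assumes LM: "ae (\<lambda>i. |L i| \<le>o |M| )" and m: "m \<in> M"
  shows "|set_ultraprod K D L| \<le>o |Func K M|"
proof -
  have "\<forall>i. \<exists>e. |L i| \<le>o |M| \<longrightarrow> inj_on e (L i) \<and> e ` L i \<subseteq> M"
    unfolding card_of_ordLeq[symmetric] by blast
  then obtain e where e: "\<And>i. |L i| \<le>o |M| \<Longrightarrow> inj_on (e i) (L i) \<and> e i ` L i \<subseteq> M"
    by metis
  define F where "F X = (\<lambda>i. if i \<in> K then if |L i| \<le>o |M| then e i (urep X i) else m else undefined)" for X
  show ?thesis
  proof (rule card_of_ordLeqI[of F])
    show "F X \<in> Func K M" if "X \<in> set_ultraprod K D L" for X
      using e m PiE_mem[OF urep_in_PiE[OF that]] by (fastforce simp: F_def Func_def)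
    show "inj_on F (set_ultraprod K D L)"
    proof (rule inj_onI)
      fix X Y assume X: "X \<in> set_ultraprod K D L" and Y: "Y \<in> set_ultraprod K D L" and FXY: "F X = F Y"
      show "X = Y"
      proof (rule ultraprod_eqI[OF X Y ae_mono[OF LM]])
        fix i assume i: "i \<in> K" "|L i| \<le>o |M|"
        then have "e i (urep X i) = e i (urep Y i)"
          using fun_cong[OF FXY, of i] by (simp add: F_def)
        then show "urep X i = urep Y i"
          using e[OF i(2)] PiE_mem[OF urep_in_PiE[OF X] i(1)] PiE_mem[OF urep_in_PiE[OF Y] i(1)]
          by (blast dest: inj_onD)
      qed
    qed
  qed
qed

text \<open>In the next lemma \<open>g\<close> represents an element of the product of the ordinals \<open>|L i|\<close>, embedded
  in \<open>|M|\<close>.\<close>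

lemma card_of_ultraprod_le_bounded:
  assumes LM: "ae (\<lambda>i. |L i| \<le>o |M| )" and m: "m \<in> M"
    and bounded: "\<And>g. (\<And>i. i \<in> K \<Longrightarrow> g i \<in> M) \<Longrightarrow> ae (\<lambda>i. |underS (card_of M) (g i)| <o |L i| ) \<Longrightarrow>
      \<exists>a\<in>M. ae (\<lambda>i. g i \<in> under (card_of M) a)"
  shows "|set_ultraprod K D L| \<le>o |\<Union>a\<in>M. Func K (under (card_of M) a)|"
proof -
  have "\<forall>i. \<exists>e. |L i| \<le>o |M| \<longrightarrow> inj_on e (L i) \<and> e ` L i \<subseteq> M \<and>
      (\<forall>x\<in>L i. |underS (card_of M) (e x)| <o |L i| )"
    by (metis initial_segment_embedding)
  then obtain e where e': "\<And>i. |L i| \<le>o |M| \<longrightarrow> inj_on (e i) (L i) \<and> e i ` L i \<subseteq> M \<and>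
      (\<forall>x\<in>L i. |underS (card_of M) (e i x)| <o |L i| )"
    by metis
  have e: "inj_on (e i) (L i)" "\<And>x. x \<in> L i \<Longrightarrow> e i x \<in> M"
    "\<And>x. x \<in> L i \<Longrightarrow> |underS (card_of M) (e i x)| <o |L i|" if "|L i| \<le>o |M|" for i
    using e'[of i] that by auto
  define g where "g X i = (if |L i| \<le>o |M| then e i (urep X i) else m)" for X i
  have U: "urep X i \<in> L i" if "X \<in> set_ultraprod K D L" "i \<in> K" for X i
    using PiE_mem[OF urep_in_PiE] that by blast
  have "\<exists>a\<in>M. ae (\<lambda>i. g X i \<in> under (card_of M) a)" if X: "X \<in> set_ultraprod K D L" for X
  proof (rule bounded)
    show "g X i \<in> M" if "i \<in> K" for i
      using U[OF X that] e(2) m by (simp add: g_def)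
    show "ae (\<lambda>i. |underS (card_of M) (g X i)| <o |L i| )"
      by (rule ae_mono[OF LM]) (use U[OF X] e(3) in \<open>simp add: g_def\<close>)
  qed
  then obtain b where b: "\<And>X. X \<in> set_ultraprod K D L \<Longrightarrow> b X \<in> M"
    "\<And>X. X \<in> set_ultraprod K D L \<Longrightarrow> ae (\<lambda>i. g X i \<in> under (card_of M) (b X))"
    by metis
  \<comment> \<open>Coordinates of \<open>g X\<close> beyond the bound are reset to
    \<open>b X\<close>. They form a set outside \<open>D\<close>, so \<open>F X\<close> still
    determines \<open>X\<close>.\<close>
  define F where "F X = (\<lambda>i. if i \<in> K then if g X i \<in> under (card_of M) (b X) then g X i else b X
    else undefined)" for X
  show ?thesis
  proof (rule card_of_ordLeqI[of F])
    fix X assume X: "X \<in> set_ultraprod K D L"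
    have "b X \<in> under (card_of M) (b X)"
      using card_of_total[OF b(1) b(1), OF X X] by (simp add: under_def)
    then have "F X \<in> Func K (under (card_of M) (b X))"
      by (auto simp: F_def Func_def)
    then show "F X \<in> (\<Union>a\<in>M. Func K (under (card_of M) a))"
      using b(1)[OF X] by blast
  next
    show "inj_on F (set_ultraprod K D L)"
    proof (rule inj_onI)
      fix X Y assume X: "X \<in> set_ultraprod K D L" and Y: "Y \<in> set_ultraprod K D L" and FXY: "F X = F Y"
      show "X = Y"
      proof (rule ultraprod_eqI[OF X Y ae_mono[OF ae_conj[OF LM ae_conj[OF b(2)[OF X] b(2)[OF Y]]]]])
        fix i assume i: "i \<in> K"
          "|L i| \<le>o |M| \<and> g X i \<in> under (card_of M) (b X) \<and> g Y i \<in> under (card_of M) (b Y)"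
        then have "g X i = g Y i"
          using fun_cong[OF FXY, of i] by (simp add: F_def)
        then have "e i (urep X i) = e i (urep Y i)"
          using i(2) by (simp add: g_def)
        then show "urep X i = urep Y i"
          using e(1) U[OF X i(1)] U[OF Y i(1)] i(2) by (blast dest: inj_onD)
      qed
    qed
  qed
qed

text \<open>\<open>UNIV\<close> bounds every \<open>L i\<close>, so a least bound exists. If
  \<open>|N| <o |M|\<close>, minimality denies \<open>|L i| \<le>o |N|\<close> almost everywhere,
  and the ultrafilter turns this into the strict reverse almost everywhere.\<close>

lemma exists_ultralimit:
  fixes L :: "'k \<Rightarrow> 'a set"
  obtains M :: "'a set" where "ae (\<lambda>i. |L i| \<le>o |M| )"
    "\<And>N :: 'a set. |N| <o |M| \<Longrightarrow> ae (\<lambda>i. |N| <o |L i| )"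
proof -
  let ?R = "card_of ` {M :: 'a set. ae (\<lambda>i. |L i| \<le>o |M| )}"
  have "ae (\<lambda>i. |L i| \<le>o |UNIV :: 'a set| )"
    by (rule ae_all) (simp add: card_of_mono1)
  then have "\<exists>r\<in>?R. \<forall>r'\<in>?R. r \<le>o r'"
    by (intro exists_minim_Card_order) (auto simp: card_of_Card_order)
  then obtain M :: "'a set" where M: "ae (\<lambda>i. |L i| \<le>o |M| )"
    "\<And>N :: 'a set. ae (\<lambda>i. |L i| \<le>o |N| ) \<Longrightarrow> |M| \<le>o |N|"
    by blast
  show thesis
  proof (rule that[OF M(1)])
    fix N :: "'a set" assume N: "|N| <o |M|"
    have "\<not> ae (\<lambda>i. |L i| \<le>o |N| )"
      using M(2)[of N] N not_ordLess_ordLeq by blast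
    from ae_not[OF this] show "ae (\<lambda>i. |N| <o |L i| )"
      by (simp add: not_ordLeq_iff_ordLess[OF card_of_Well_order card_of_Well_order])
  qed
qed

end

section \<open>The pi-weight compared with the ultraproduct of cardinals\<close>

theorem theorem1p1:
  fixes K :: "'k set" and D :: "'k set set"
    and A :: "'k \<Rightarrow> 'a balg" and L :: "'k \<Rightarrow> 'a set"
  assumes sch: "SCH TYPE(('k \<Rightarrow> 'a) set)"
    and D: "ultrafilter_on K D"
    and BA: "\<forall>i\<in>K. boolean_algebra (A i) \<and> infinite (bcarrier (A i))"
    and piA: "\<forall>i\<in>K. min_dense_set (A i) (L i)"
    and big: "\<forall>i\<in>K. ordLess2 (card_of (Pow K)) (card_of (L i))"
  shows "\<forall>Y. min_dense_set (ultraprod K D A) Y \<longrightarrow>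
           ordIso2 (card_of Y) (card_of (set_ultraprod K D L))"
proof (intro allI impI)
  fix Y assume Y: "min_dense_set (ultraprod K D A) Y"
  interpret ultra K D by unfold_locales (rule D)
  have BA': "\<forall>i\<in>K. boolean_algebra (A i)"
    using BA by blast
  have dense: "dense_set (A i) (L i)" if "i \<in> K" for i
    using piA that unfolding min_dense_set_def by blast
  have inf: "infinite (L i)" if "i \<in> K" for i
    using infinite_dense_set[OF _ _ dense[OF that]] BA that by blast
  have Yd: "dense_set (ultraprod K D A) Y"
    using Y unfolding min_dense_set_def by blast

  have "|Y| \<le>o |ucls K D (\<lambda>i. bcarrier (A i)) ` PiE K L|"
    using Y dense_set_ultraprod[OF BA', of L] dense inf unfolding min_dense_set_def
    by (metis finite.emptyI)
  \<comment> \<open>The classes on the left are formed in the product of the carriers, those on the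
    right in the product of the \<open>L i\<close>; rereading a representative in the larger product
    maps the right onto the left.\<close>
  also have "|ucls K D (\<lambda>i. bcarrier (A i)) ` PiE K L| \<le>o |set_ultraprod K D L|"
  proof (rule surj_imp_ordLeq[of _ "\<lambda>X. ucls K D (\<lambda>i. bcarrier (A i)) (urep X)"], rule subsetI)
    fix x assume "x \<in> ucls K D (\<lambda>i. bcarrier (A i)) ` PiE K L"
    then obtain f where f: "f \<in> PiE K L" "x = ucls K D (\<lambda>i. bcarrier (A i)) f"
      by blast
    let ?X = "ucls K D L f"
    have X: "?X \<in> set_ultraprod K D L"
      by (rule ucls_in_ultraprod[OF f(1)])
    have sub: "PiE K L \<subseteq> PiE K (\<lambda>i. bcarrier (A i))"
      using dense by (intro PiE_mono) (auto simp: dense_set_def)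
    have "x = ucls K D (\<lambda>i. bcarrier (A i)) (urep ?X)"
      using iffD2[OF ucls_eq_iff ae_urep_ucls, OF subsetD subsetD, OF sub urep_in_PiE[OF X] sub f(1) f(1)]
      by (simp only: f(2))
    then show "x \<in> (\<lambda>X. ucls K D (\<lambda>i. bcarrier (A i)) (urep X)) ` set_ultraprod K D L"
      using X by blast
  qed
  finally have upper: "|Y| \<le>o |set_ultraprod K D L|" .

  obtain M :: "'a set" where LM: "ae (\<lambda>i. |L i| \<le>o |M| )"
    and small: "\<And>N :: 'a set. |N| <o |M| \<Longrightarrow> ae (\<lambda>i. |N| <o |L i| )"
    using exists_ultralimit by blast
  obtain i where i: "i \<in> K" "|L i| \<le>o |M|"
    using LM by (rule ae_ex)
  have infM: "infinite M"
    by (rule card_of_ordLeq_infinite[OF i(2) inf[OF i(1)]])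
  then obtain m where m: "m \<in> M"
    using infinite_imp_nonempty by blast
  have PM: "|Pow K| <o |M|"
    using big i ordLess_ordLeq_trans by blast
  \<comment> \<open>Singletons of constant functions embed \<open>'a\<close> into the type for which
    SCH is assumed.\<close>
  have "inj (\<lambda>a. {\<lambda>_. a} :: ('k \<Rightarrow> 'a) set)"
    by (rule injI) (metis singleton_inject)
  note power = sch_card_of_Func_inj[OF sch this]
  have MY: "|M| \<le>o |Y|"
  proof (rule ccontr)
    assume "\<not> |M| \<le>o |Y|"
    then have "|Y| <o |M|"
      by (simp add: not_ordLeq_iff_ordLess[OF card_of_Well_order card_of_Well_order])
    \<comment> \<open>\<open>Y\<close> lives in another type; \<open>small\<close> applies to its
      copy \<open>N\<close> over \<open>'a\<close>.\<close>
    from iffD1[OF internalize_card_of_ordLess this]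
    obtain N :: "'a set" where N: "|Y| =o |N|" "|N| <o |M|"
      by blast
    have "ae (\<lambda>i. |Y| <o |L i| )"
      by (rule ae_mono[OF small[OF N(2)]]) (rule ordIso_ordLess_trans[OF N(1)])
    then show False
      using not_dense_set_ultraprod[OF BA' piA, of "\<lambda>_. Y" Y] Yd ae_all[of "\<lambda>_. _ \<in> Y"] by blast
  qed
  \<comment> \<open>In the case split \<open>g i\<close> stands for an ordinal below
    \<open>|L i|\<close>, and the last clause says that the \<open>D\<close>-limit of the
    \<open>g i\<close> is all of \<open>|M|\<close>.\<close>
  have lower: "|set_ultraprod K D L| \<le>o |Y|"
  proof (cases "\<exists>g. (\<forall>i\<in>K. g i \<in> M) \<and> ae (\<lambda>i. |underS (card_of M) (g i)| <o |L i| ) \<and>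
      (\<forall>a\<in>M. ae (\<lambda>i. a \<in> underS (card_of M) (g i)))")
    case True
    then obtain g where g: "ae (\<lambda>i. |underS (card_of M) (g i)| <o |L i| )"
      "\<And>a. a \<in> M \<Longrightarrow> ae (\<lambda>i. a \<in> underS (card_of M) (g i))"
      by blast
    have "|M| <o |Y|"
    proof (rule ccontr)
      assume "\<not> |M| <o |Y|"
      then have "|Y| \<le>o |M|"
        by (simp add: not_ordLess_iff_ordLeq[OF card_of_Well_order card_of_Well_order])
      then obtain h where h: "inj_on h Y" "h ` Y \<subseteq> M"
        unfolding card_of_ordLeq[symmetric] by blast
      \<comment> \<open>\<open>h\<close> indexes \<open>Y\<close> by \<open>M\<close>, and
        coordinate \<open>i\<close> handles the members with index below \<open>g i\<close>: fewer
        than \<open>|L i|\<close> almost everywhere, yet each \<open>y\<close> is handled almost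
        everywhere.\<close>
      let ?Z = "\<lambda>i. {y\<in>Y. h y \<in> underS (card_of M) (g i)}"
      have "|?Z i| \<le>o |underS (card_of M) (g i)|" for i
        using h(1) by (intro card_of_ordLeqI[of h]) (auto simp: inj_on_def)
      then have "ae (\<lambda>i. |?Z i| <o |L i| )"
        by (intro ae_mono[OF g(1)]) (rule ordLeq_ordLess_trans)
      moreover have "ae (\<lambda>i. y \<in> ?Z i)" if "y \<in> Y" for y
        using that h(2) by (intro ae_mono[OF g(2)[of "h y"]]) auto
      ultimately show False
        using not_dense_set_ultraprod[OF BA' piA, of ?Z Y] Yd by blast
    qed
    then have sucY: "cardSuc (card_of M) \<le>o |Y|"
      by (rule cardSuc_least[OF card_of_Card_order card_of_Card_order])
    show ?thesis
      by (rule ordLeq_transitive[OF card_of_ultraprod_le_Func[OF LM m]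
        ordLeq_transitive[OF power[OF infM PM] sucY]])
  next
    case False
    have "|set_ultraprod K D L| \<le>o |\<Union>a\<in>M. Func K (under (card_of M) a)|"
    proof (rule card_of_ultraprod_le_bounded[OF LM m])
      fix g assume g: "\<And>i. i \<in> K \<Longrightarrow> g i \<in> M" "ae (\<lambda>i. |underS (card_of M) (g i)| <o |L i| )"
      then obtain a where a: "a \<in> M" "\<not> ae (\<lambda>i. a \<in> underS (card_of M) (g i))"
        using False by blast
      \<comment> \<open>Since \<open>D\<close> is an ultrafilter, not exceeding \<open>a\<close>
        almost everywhere means being at most \<open>a\<close> almost everywhere.\<close>
      have "ae (\<lambda>i. g i \<in> under (card_of M) a)"
        by (rule ae_mono[OF ae_not[OF a(2)]])
          (use card_of_total[OF a(1) g(1)] in \<open>auto simp: underS_def under_def\<close>)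
      then show "\<exists>a\<in>M. ae (\<lambda>i. g i \<in> under (card_of M) a)"
        using a(1) by blast
    qed
    \<comment> \<open>A union of at most \<open>|M|\<close> sets, each of size at most
      \<open>|M|\<close> because \<open>under (card_of M) a\<close> is smaller than \<open>M\<close>
      and \<open>power\<close> fills the premise \<open>IH\<close>.\<close>
    also have "|\<Union>a\<in>M. Func K (under (card_of M) a)| \<le>o |M|"
    proof (rule card_of_UNION_ordLeq_infinite[OF infM ordLeq_refl[OF card_of_Card_order]], rule ballI)
      fix a assume "a \<in> M"
      then show "|Func K (under (card_of M) a)| \<le>o |M|"
        by (intro card_of_Func_le_of_smaller[OF power infM PM] card_of_under_less[OF infM])
    qed
    finally show ?thesis
      using MY by (rule ordLeq_transitive)
  qed
  show "|Y| =o |set_ultraprod K D L|"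
    using upper lower by (simp add: ordIso_iff_ordLeq)
qed

end
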